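(* Let $\mathscr{R}$ be a ratio-covariety, and let $\mathrm{G}(\mathscr{R})$ be the graph whose set of vertices is $\mathscr{R}$ and in which $(S,T)\in\mathscr{R}\times\mathscr{R}$ is an edge if and only if $T=S\setminus\{\mathrm{r}(S)\}$. Then $\mathrm{G}(\mathscr{R})$ is a tree with root $\min(\mathscr{R})$.
   Context: $\mathbb{N}$ is the set of nonnegative integers. A numerical semigroup is a submonoid $S$ of $(\mathbb{N},+)$ with $\mathbb{N}\setminus S$ finite. Its multiplicity is $\mathrm{m}(S)=\min(S\setminus\{0\})$. If $S\neq\mathbb{N}$, the ratio of $S$ is $\mathrm{r}(S)=\min\{s\in S\mid \mathrm{m}(S)\nmid s\}$ (equivalently, the smallest minimal generator of $S$ different from $\mathrm{m}(S)$). A ratio-covariety is a nonempty family $\mathscr{R}$ of numerical semigroups such that: 1) $\mathscr{R}$ has a minimum with respect to inclusion, denoted $\min(\mathscr{R})$; 2) if $S,T\in\mathscr{R}$ then $S\cap T\in\mathscr{R}$; 3) if $S\in\mathscr{R}$ and $S\neq\min(\mathscr{R})$, then $S\setminus\{\mathrm{r}(S)\}\in\mathscr{R}$ (in particular $\mathrm{r}(S)$ is defined, i.e. $S\neq\mathbb{N}$). A graph is a pair $(V,E)$ with $V$ a nonempty set (vertices) and $E\subseteq\{(u,v)\in V\times V\mid u\neq v\}$ (edges). A path of length $n$ connecting $x$ and $y$ is a sequence of different edges $(v_0,v_1),(v_1,v_2),\ldots,(v_{n-1},v_n)$ with $v_0=x$, $v_n=y$. A graph is a tree with root $r$ if for every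 vertex $x\neq r$ there is a unique path connecting $x$ and $r$. *)

theory Defs
  imports "Graph_Theory.Pair_Digraph"
begin

definition numerical_semigroup :: "nat set \<Rightarrow> bool" where
  "numerical_semigroup S \<longleftrightarrow>
     0 \<in> S \<and> (\<forall>x\<in>S. \<forall>y\<in>S. x + y \<in> S) \<and> finite (UNIV - S)"

definition multiplicity_ns :: "nat set \<Rightarrow> nat" where
  "multiplicity_ns S = (LEAST s. s \<in> S - {0})"

(* Only meaningful for numerical semigroups S \<noteq> UNIV; for S = UNIV there is no such s
   and the value is unspecified, so uses of this function are guarded by S \<noteq> UNIV. *)
definition ratio :: "nat set \<Rightarrow> nat" where
  "ratio S = (LEAST s. s \<in> S \<and> \<not> multiplicity_ns S dvd s)"

(* The minimum of a family is its least element for \<subseteq>, i.e. (LEAST S. S \<in> R) in the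
   inclusion order on nat set; its existence is the third conjunct. *)
definition ratio_covariety :: "nat set set \<Rightarrow> bool" where
  "ratio_covariety R \<longleftrightarrow>
     R \<noteq> {} \<and>
     (\<forall>S\<in>R. numerical_semigroup S) \<and>
     (\<exists>M\<in>R. \<forall>S\<in>R. M \<subseteq> S) \<and>
     (\<forall>S\<in>R. \<forall>T\<in>R. S \<inter> T \<in> R) \<and>
     (\<forall>S\<in>R. S \<noteq> (LEAST M. M \<in> R) \<longrightarrow> S \<noteq> UNIV \<and> S - {ratio S} \<in> R)"

definition ratio_graph :: "nat set set \<Rightarrow> nat set pair_pre_digraph" where
  "ratio_graph R =
     \<lparr> pverts = R,
       parcs = {(S, T) \<in> R \<times> R. S \<noteq> UNIV \<and> T = S - {ratio S}} \<rparr>"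

(* Graphs are loop-free, possibly infinite digraphs with a nonempty vertex set, whose
   edges are ordered pairs of vertices.  A path is a sequence of different edges, which
   the library calls a trail (its apath requires different vertices instead).  The
   constant tree of Digraph_Component is the unrooted, undirected notion and is not
   what is meant here. *)
definition tree_with_root :: "'a pair_pre_digraph \<Rightarrow> 'a \<Rightarrow> bool" where
  "tree_with_root G r \<longleftrightarrow>
     pair_loopfree_digraph G \<and> pverts G \<noteq> {} \<and> r \<in> pverts G \<and>
     (\<forall>x\<in>pverts G. x \<noteq> r \<longrightarrow> (\<exists>!p. pre_digraph.trail (with_proj G) x p r))"

end

theory Submission
  imports Defs
begin

text \<open>
  Removing the ratio defines a parent function on \<open>\<R> - {min \<R>}\<close>, so every vertex has at most one
  outgoing edge, and only the root has none. Along an edge from \<open>S\<close> to \<open>T\<close>, exactly the element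
  \<open>ratio S\<close> is lost. It really lies in \<open>S\<close> (lemma \<open>ratio_in_semigroup\<close>), and not in \<open>min \<R>\<close>,
  because \<open>T\<close> is again a member of the family and hence contains \<open>min \<R>\<close>. So the size of
  \<open>S - min \<R>\<close>, which is finite because \<open>min \<R>\<close> is cofinite, drops at each edge: the family may be
  infinite, but every chain of parents stops, and it can only stop at the root. This gives a path
  from each vertex to the root, and determinism of the parent function makes it unique.

  The passage from decreasing measure to tree concerns graphs only: lemma \<open>tree_with_root_if_wf_parent\<close> shows
  that any graph whose edges form a well-founded parent function is a rooted tree.
\<close>

section \<open>Rooted trees from parent functions\<close>

text \<open>
  The tails of the arcs of a walk are vertices of that walk, so a repeated arc repeats a vertex.
\<close>

lemma (in pre_digraph) trail_if_apath:
  assumes "apath u p v"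
  shows "trail u p v"
  using assms unfolding apath_def trail_def awalk_verts_conv
  by (auto simp: distinct_map split: if_splits)

text \<open>
  A walk that starts in \<open>x\<close> has no choice at any step, and it cannot run through the sink \<open>r\<close>;
  so its end \<open>r\<close> also fixes its length.
\<close>

lemma (in wf_digraph) awalk_to_sink_unique:
  assumes det: "\<And>e e'. \<lbrakk>e \<in> arcs G; e' \<in> arcs G; tail G e = tail G e'\<rbrakk> \<Longrightarrow> e = e'"
    and sink: "\<And>e. e \<in> arcs G \<Longrightarrow> tail G e \<noteq> r"
    and "awalk x p r" "awalk x q r"
  shows "p = q"
  using assms(3,4)
proof (induction p arbitrary: x q)
  case Nil
  then show ?case
    using sink by (cases q) (auto simp: awalk_simps)
next
  case (Cons e p)
  then obtain e' q' where q: "q = e' # q'"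
    using sink by (cases q) (auto simp: awalk_simps)
  have "e = e'"
    using Cons.prems det unfolding q by (auto simp: awalk_simps)
  then show ?case
    using Cons q by (auto simp: awalk_simps)
qed

text \<open>
  Well-foundedness of the converse edge relation replaces finiteness: it excludes loops and
  infinite chains of parents, even if the graph has infinitely many vertices.
\<close>

lemma tree_with_root_if_wf_parent:
  fixes G :: "'a pair_pre_digraph"
  assumes root: "r \<in> pverts G"
    and verts: "parcs G \<subseteq> pverts G \<times> pverts G"
    and wf: "wf ((parcs G)\<inverse>)"
    and parent: "\<And>x. x \<in> pverts G \<Longrightarrow> x \<noteq> r \<Longrightarrow> \<exists>y. (x, y) \<in> parcs G"
    and parent_unique: "single_valued (parcs G)"
    and sink: "r \<notin> Domain (parcs G)"
  shows "tree_with_root G r"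
proof -
  interpret pair_loopfree_digraph G
  proof
    show "fst e \<noteq> snd e" if "e \<in> parcs G" for e
      using that wf_not_refl[OF wf, of "fst e"] by (cases e) auto
  qed (use verts in auto)
  have reach: "x \<rightarrow>\<^sup>*\<^bsub>with_proj G\<^esub> r" if "x \<in> pverts G" for x
    using wf that
  proof (induction x rule: wf_induct_rule)
    case (less x)
    show ?case
    proof (cases "x = r")
      case True
      then show ?thesis using root by simp
    next
      case False
      then obtain y where xy: "(x, y) \<in> parcs G"
        using parent less.prems by blast
      then have "y \<rightarrow>\<^sup>*\<^bsub>with_proj G\<^esub> r"
        using less.IH verts by blast
      then show ?thesis
        using xy by (metis adj_reachable_trans)
    qed
  qed
  have "\<exists>!p. trail x p r" if "x \<in> pverts G" for x
  proof (rule ex_ex1I)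
    show "\<exists>p. trail x p r"
      using reach[OF that] unfolding reachable_apath by (blast intro: trail_if_apath)
    show "p = q" if "trail x p r" "trail x q r" for p q
    proof (rule awalk_to_sink_unique)
      show "e = e'" if "e \<in> parcs G" "e' \<in> parcs G" "fst e = fst e'" for e e'
        using that parent_unique by (cases e; cases e') (auto dest: single_valuedD)
      show "fst e \<noteq> r" if "e \<in> parcs G" for e
        using that sink by (cases e) auto
    qed (use that in \<open>auto simp: trail_def\<close>)
  qed
  then show ?thesis
    unfolding tree_with_root_def using root pair_loopfree_digraph_axioms by blast
qed

section \<open>Removing the ratio of a numerical semigroup\<close>

text \<open>
  The least element in the definition of the ratio exists: a multiplicity of \<open>1\<close> would generate
  all of \<open>\<nat>\<close>, and for a multiplicity \<open>m > 1\<close> the infinitely many numbers \<open>k m + 1\<close> cannot all be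
  gaps.
\<close>

lemma ratio_in_semigroup:
  assumes S: "numerical_semigroup S" and "S \<noteq> UNIV"
  shows "ratio S \<in> S"
proof -
  define m where "m = multiplicity_ns S"
  have fin: "finite (- S)"
    using S by (simp add: numerical_semigroup_def Compl_eq_Diff_UNIV)
  then have "infinite (S - {0})"
    using finite_compl[of S] infinite_UNIV_nat by auto
  then obtain s where "s \<in> S - {0}"
    using infinite_imp_nonempty by blast
  then have m: "m \<in> S - {0}"
    unfolding m_def multiplicity_ns_def by (rule LeastI)
  have "m \<noteq> 1"
  proof
    assume "m = 1"
    have "n \<in> S" for n
    proof (induction n)
      case 0
      then show ?case using S by (simp add: numerical_semigroup_def)
    next
      case (Suc n)
      then show ?case
        using S m \<open>m = 1\<close> unfolding numerical_semigroup_def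
        by (metis DiffD1 Suc_eq_plus1)
    qed
    then show False using \<open>S \<noteq> UNIV\<close> by blast
  qed
  have "infinite (range (\<lambda>k. k * m + 1))"
    using m by (intro range_inj_infinite) (auto simp: inj_def)
  then obtain k where "k * m + 1 \<in> S"
    using fin finite_subset[of "range (\<lambda>k. k * m + 1)" "- S"] by blast
  moreover have "\<not> m dvd k * m + 1"
    using \<open>m \<noteq> 1\<close> dvd_add_right_iff[of m "k * m" 1] by simp
  ultimately have "\<exists>s. s \<in> S \<and> \<not> multiplicity_ns S dvd s"
    unfolding m_def by blast
  then show ?thesis
    unfolding ratio_def by (rule LeastI2_ex) simp
qed

text \<open>
  The measure behind termination. The inclusion of \<open>M\<close> in \<open>S - {ratio S}\<close> puts the removed
  element outside \<open>M\<close>; for the minimum \<open>M\<close> of a ratio-covariety it holds along every edge,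
  because \<open>S - {ratio S}\<close> is then a member.
\<close>

lemma card_diff_remove_ratio_less:
  assumes S: "numerical_semigroup S" "S \<noteq> UNIV"
    and M: "M \<subseteq> S - {ratio S}" "numerical_semigroup M"
  shows "card (S - {ratio S} - M) < card (S - M)"
proof (rule psubset_card_mono)
  show "finite (S - M)"
    using M(2) unfolding numerical_semigroup_def by (auto intro: finite_subset[of _ "UNIV - M"])
  show "S - {ratio S} - M \<subset> S - M"
    using ratio_in_semigroup[OF S] M(1) by blast
qed

theorem proposition2p4:
  fixes R :: "nat set set"
  assumes "ratio_covariety R"
  shows "tree_with_root (ratio_graph R) (LEAST M. M \<in> R)"
proof -
  define M where "M = (LEAST M. M \<in> R)"
  have ns: "numerical_semigroup S" if "S \<in> R" for S
    using assms that by (simp add: ratio_covariety_def)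
  have "\<exists>N\<in>R. \<forall>S\<in>R. N \<subseteq> S"
    using assms by (simp add: ratio_covariety_def)
  then obtain N where N: "N \<in> R" "\<And>S. S \<in> R \<Longrightarrow> N \<subseteq> S"
    by blast
  then have "M = N"
    unfolding M_def by (intro Least_equality) auto
  then have M: "M \<in> R" "\<And>S. S \<in> R \<Longrightarrow> M \<subseteq> S"
    using N by auto
  have arc: "(S, T) \<in> parcs (ratio_graph R) \<longleftrightarrow>
      S \<in> R \<and> T \<in> R \<and> S \<noteq> UNIV \<and> T = S - {ratio S}" for S T
    by (auto simp: ratio_graph_def)
  have less: "card (T - M) < card (S - M)" if "(S, T) \<in> parcs (ratio_graph R)" for S T
    using that card_diff_remove_ratio_less[of S M] ns[of S] ns[of M] M unfolding arc by blast
  have "tree_with_root (ratio_graph R) M"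
  proof (rule tree_with_root_if_wf_parent)
    show "M \<in> pverts (ratio_graph R)"
      using M by (simp add: ratio_graph_def)
    show "parcs (ratio_graph R) \<subseteq> pverts (ratio_graph R) \<times> pverts (ratio_graph R)"
      by (auto simp: ratio_graph_def)
    show "wf ((parcs (ratio_graph R))\<inverse>)"
      by (rule wf_subset[OF wf_measure[of "\<lambda>S. card (S - M)"]]) (auto dest: less)
    show "\<exists>T. (S, T) \<in> parcs (ratio_graph R)" if "S \<in> pverts (ratio_graph R)" "S \<noteq> M" for S
      using assms that unfolding arc ratio_covariety_def M_def by (auto simp: ratio_graph_def)
    show "single_valued (parcs (ratio_graph R))"
      by (auto simp: single_valued_def arc)
    show "M \<notin> Domain (parcs (ratio_graph R))"
      using less[of M] by auto
  qed
  then show ?thesis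
    by (simp add: M_def)
qed

end
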